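(* Let $A$ be a real symmetric positive definite matrix with smallest eigenvalue $\lambda_{\min}$ and largest eigenvalue $\lambda_{\max}$, where $\lambda_{\min}<\lambda_{\max}$, and let $0<\beta<1$. Let $\tau=\sqrt{\lambda_{\min}\lambda_{\max}}$, and for each $k\ge 1$ let $R_k(A)$ be the rational approximation of $A^\beta$ generated by the $k$-point Gauss-Jacobi rule with this value of $\tau$ (as defined in the context). Let $\kappa(A)=\lambda_{\max}/\lambda_{\min}$ and $$\gamma=\frac{\sqrt{\kappa(A)}+1}{\sqrt{\kappa(A)}-1},\qquad \rho_M=\gamma+\sqrt{\gamma^2-1}.$$ Then there is a constant $C$ independent of $k$ such that, for all sufficiently large $k$, $$\left\Vert A^{\beta}-R_k(A)\right\Vert_2\le C\,\left\Vert A\right\Vert_2\,\tau^{\beta}\,\frac{\rho_M+1}{(\rho_M-1)(\rho_M-\gamma)}\,\frac{k}{\rho_M^{2k}}.$$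
   Context: $\|\cdot\|_2$ is the spectral norm, and $I$ is the identity matrix of the same size as $A$. For $0<\beta<1$ and $\tau>0$, the fractional power of $A$ has the integral representation $$A^{\beta}=A\,\frac{\sin(\beta\pi)}{\pi}\,2\tau^{\beta}\int_{-1}^{1}(1-t)^{\beta-1}(1+t)^{-\beta}\left(\tau(1-t)I+(1+t)A\right)^{-1}dt.$$ For $k\ge 1$, let $\vartheta_1,\dots,\vartheta_k\in(-1,1)$ and $w_1,\dots,w_k>0$ be the nodes and weights of the $k$-point Gauss-Jacobi quadrature rule on $[-1,1]$ with weight function $(1-t)^{\beta-1}(1+t)^{-\beta}$. Applying this rule to the integral above yields the rational approximation $$R_k(A)=A\sum_{j=1}^{k}\gamma_j\,(\eta_j I+A)^{-1},\qquad \gamma_j=\frac{2\sin(\beta\pi)\tau^{\beta}}{\pi}\,\frac{w_j}{1+\vartheta_j},\qquad \eta_j=\frac{\tau(1-\vartheta_j)}{1+\vartheta_j}.$$ The coefficients $\gamma_j$ are not to be confused with the scalar $\gamma$ (without index) in the claim. *)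

theory Defs
  imports "HOL-Analysis.Analysis" "HOL-Computational_Algebra.Polynomial"
begin

definition spectral_norm :: "real^'n^'n \<Rightarrow> real" where
  "spectral_norm A = onorm (\<lambda>x. A *v x)"

definition sym_pos_def :: "real^'n^'n \<Rightarrow> bool" where
  "sym_pos_def A \<longleftrightarrow> transpose A = A \<and> (\<forall>x. x \<noteq> 0 \<longrightarrow> 0 < x \<bullet> (A *v x))"

definition eigenvalues :: "real^'n^'n \<Rightarrow> real set" where
  "eigenvalues A = {l. \<exists>v. v \<noteq> 0 \<and> A *v v = l *\<^sub>R v}"

definition diag_matrix :: "real^'n \<Rightarrow> real^'n^'n" where
  "diag_matrix d = (\<chi> i j. if i = j then d $ i else 0)"

text \<open>
  The real power of a symmetric positive definite matrix through an orthogonal diagonalisation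
  \<open>A = Q D Q\<^sup>T\<close>. The result does not depend on the choice of \<open>Q\<close> and \<open>D\<close>.
\<close>

definition matrix_powr :: "real^'n^'n \<Rightarrow> real \<Rightarrow> real^'n^'n" where
  "matrix_powr A \<beta> = (THE B. \<exists>Q d. orthogonal_matrix Q
      \<and> A = Q ** diag_matrix d ** transpose Q
      \<and> B = Q ** diag_matrix (\<chi> i. (d $ i) powr \<beta>) ** transpose Q)"

text \<open>
  A \<open>k\<close>-point Gauss rule for the weight function \<open>\<omega>\<close> on \<open>[-1,1]\<close> is the \<open>k\<close>-point rule
  that is exact for all polynomials of degree at most \<open>2 * k - 1\<close>; this determines the nodes (up to
  their order) and the weights. Nodes and weights are indexed by \<open>{1..k}\<close>; values at other
  indices are irrelevant.
\<close>

definition gauss_rule :: "(real \<Rightarrow> real) \<Rightarrow> nat \<Rightarrow> (nat \<Rightarrow> real) \<Rightarrow> (nat \<Rightarrow> real) \<Rightarrow> bool" where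
  "gauss_rule \<omega> k \<theta> w \<longleftrightarrow>
     inj_on \<theta> {1..k} \<and> (\<forall>j\<in>{1..k}. -1 < \<theta> j \<and> \<theta> j < 1 \<and> 0 < w j) \<and>
     (\<forall>p :: real poly. degree p < 2 * k \<longrightarrow>
        ((\<lambda>t. \<omega> t * poly p t) has_integral (\<Sum>j=1..k. w j * poly p (\<theta> j))) {-1..1})"

text \<open>
  The Jacobi weight function; at the end points, where it may be singular, \<open>powr\<close> yields the
  value \<open>0\<close>, which does not affect the integrals.
\<close>

definition jacobi_weight :: "real \<Rightarrow> real \<Rightarrow> real" where
  "jacobi_weight \<beta> t = (1 - t) powr (\<beta> - 1) * (1 + t) powr (- \<beta>)"

text \<open>
  The Gauss rule for \<open>jacobi_weight \<beta>\<close> is applied to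
  \<open>A\<^sup>\<beta> = A (2 sin(\<beta>\<pi>) \<tau>\<^sup>\<beta> / \<pi>) \<integral> jacobi_weight \<beta> t (\<tau> (1 - t) I + (1 + t) A)\<^sup>-\<^sup>1 dt\<close> over \<open>[-1,1]\<close>;
  pulling the factor \<open>1 + t\<close> out of the inverse gives the coefficients and shifts below.
\<close>

definition gj_coeff :: "real \<Rightarrow> real \<Rightarrow> real \<Rightarrow> real \<Rightarrow> real" where
  "gj_coeff \<beta> \<tau> wj tj = 2 * sin (\<beta> * pi) * \<tau> powr \<beta> / pi * (wj / (1 + tj))"

definition gj_shift :: "real \<Rightarrow> real \<Rightarrow> real" where
  "gj_shift \<tau> tj = \<tau> * (1 - tj) / (1 + tj)"

definition gj_approx ::
    "real \<Rightarrow> real \<Rightarrow> nat \<Rightarrow> (nat \<Rightarrow> real) \<Rightarrow> (nat \<Rightarrow> real) \<Rightarrow> real^'n^'n \<Rightarrow> real^'n^'n" where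
  "gj_approx \<beta> \<tau> k \<theta> w A =
     A ** (\<Sum>j=1..k. gj_coeff \<beta> \<tau> (w j) (\<theta> j) *\<^sub>R
                      matrix_inv (gj_shift \<tau> (\<theta> j) *\<^sub>R mat 1 + A))"

end

theory Submission
  imports Defs
begin

text \<open>
  Both \<open>A\<^sup>\<beta>\<close> and \<open>R\<^sub>k(A)\<close> are functions of \<open>A\<close>, so both are diagonal in any orthonormal
  eigenbasis of the symmetric matrix \<open>A\<close>, and the spectral norm of their difference is at most the
  largest scalar error \<open>\<bar>x\<^sup>\<beta> - R\<^sub>k(x)\<bar>\<close> over the eigenvalues \<open>x\<close> (lemmas
  \<open>symmetric_matrix_diagonalizable\<close>, \<open>diagonalized_by_matrix_powr\<close>,
  \<open>diagonalized_by_gj_approx\<close>, \<open>spectral_norm_le_if_diagonalized_by\<close>).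

  The integral representation of \<open>x\<^sup>\<beta>\<close> is an Euler Beta integral after a Moebius substitution
  (\<open>has_integral_jacobi_resolvent\<close>). Hence the scalar error is a fixed multiple of the error of
  the Gauss rule on \<open>f(t) = 1 / (\<tau> (1 - t) + x (1 + t))\<close>. A Gauss rule with \<open>k\<close> points is
  exact in degree below \<open>2 k\<close> and has nonnegative weights, so its error is at most twice the mass of
  the weight times the distance from \<open>f\<close> to those polynomials (\<open>gauss_rule_error_le\<close>).

  The function \<open>f\<close> has at most one pole \<open>z\<close>, and the choice \<open>\<tau> = sqrt (lmin * lmax)\<close> gives
  \<open>\<bar>z\<bar> \<ge> \<gamma>\<close> for every eigenvalue \<open>x\<close> (\<open>geometric_mean_balances_poles\<close>). With
  the Chebyshev polynomial \<open>T\<close> of degree \<open>2 k\<close>, the function \<open>f(t) (1 - T(t) / T(z))\<close> is a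
  polynomial of degree below \<open>2 k\<close>, because its numerator vanishes at the pole. It differs from
  \<open>f\<close> by \<open>f(t) T(t) / T(z)\<close>, which is at most \<open>2 f(t) / \<rho>\<^sup>2\<^sup>k\<close> on the interval, as
  \<open>\<bar>T\<bar> \<le> 1\<close> there while \<open>\<bar>T(z)\<bar> \<ge> \<rho>\<^sup>2\<^sup>k / 2\<close>
  (\<open>reciprocal_affine_approx_by_poly\<close>).

  The outcome is an error of order \<open>\<rho>\<^sup>-\<^sup>2\<^sup>k\<close> with an explicit constant, valid for all
  \<open>k \<ge> 1\<close>. Since \<open>1 \<le> k\<close> and the remaining factors of the claimed bound are positive and
  independent of \<open>k\<close>, this is absorbed into \<open>C\<close>.
\<close>

section \<open>Chebyshev polynomials outside the unit interval\<close>

fun chebyshev_poly :: "nat \<Rightarrow> real poly" where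
  "chebyshev_poly 0 = 1"
| "chebyshev_poly (Suc 0) = [:0, 1:]"
| "chebyshev_poly (Suc (Suc n)) = [:0, 2:] * chebyshev_poly (Suc n) - chebyshev_poly n"

lemma degree_chebyshev_poly: "degree (chebyshev_poly n) \<le> n"
proof (induction n rule: chebyshev_poly.induct)
  case (3 n)
  have "degree ([:0, 2:] * chebyshev_poly (Suc n)) \<le> Suc (Suc n)"
    using degree_mult_le[of "[:0, 2:]" "chebyshev_poly (Suc n)"] 3 by simp
  then show ?case using 3 by (auto intro!: degree_diff_le)
qed auto

lemma poly_chebyshev_cos: "poly (chebyshev_poly n) (cos x) = cos (real n * x)"
proof (induction n rule: chebyshev_poly.induct)
  case (3 n)
  have "cos (real (Suc (Suc n)) * x) + cos (real n * x) = 2 * cos x * cos (real (Suc n) * x)"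
    using cos_plus_cos[of "real (Suc (Suc n)) * x" "real n * x"]
    by (simp add: algebra_simps add_divide_distrib)
  then show ?case using 3 by simp
qed auto

lemma abs_poly_chebyshev_le_1:
  assumes "\<bar>t\<bar> \<le> 1"
  shows "\<bar>poly (chebyshev_poly n) t\<bar> \<le> 1"
  using poly_chebyshev_cos[of n "arccos t"] assms by (simp add: abs_le_iff)

text \<open>
  The counterpart outside \<open>[-1,1]\<close> of the cosine formula, with \<open>x\<close> in the place of
  \<open>exp (i \<phi>)\<close>; it exhibits the geometric growth of the polynomials there.
\<close>

lemma poly_chebyshev_joukowski:
  assumes "x \<noteq> 0"
  shows "poly (chebyshev_poly n) ((x + 1 / x) / 2) = (x ^ n + (1 / x) ^ n) / 2"
proof (induction n rule: chebyshev_poly.induct)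
  case (3 n)
  have "(x + 1 / x) * (x ^ Suc n + (1 / x) ^ Suc n) - (x ^ n + (1 / x) ^ n)
      = x ^ Suc (Suc n) + (1 / x) ^ Suc (Suc n)"
    using assms by (simp add: field_simps)
  then show ?case using 3 by (simp add: field_simps)
qed auto

text \<open>
  Every real \<open>z\<close> with \<open>\<bar>z\<bar> > 1\<close> is \<open>(x + 1 / x) / 2\<close> for a real \<open>x\<close> of the same sign with
  \<open>\<bar>x\<bar> = \<bar>z\<bar> + sqrt (z\<^sup>2 - 1)\<close>. The powers of \<open>x\<close> and \<open>1 / x\<close> have equal signs, so
  they do not cancel.
\<close>

lemma abs_poly_chebyshev_ge:
  assumes "1 < g" "g \<le> \<bar>z\<bar>"
  shows "(g + sqrt (g\<^sup>2 - 1)) ^ n / 2 \<le> \<bar>poly (chebyshev_poly n) z\<bar>"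
proof -
  define s where "s = sqrt (z\<^sup>2 - 1)"
  have z1: "1 < \<bar>z\<bar>" using assms by simp
  have gz: "g\<^sup>2 \<le> z\<^sup>2" using power_mono[of g "\<bar>z\<bar>" 2] assms by simp
  have g1: "1 \<le> g\<^sup>2" using assms(1) by (simp add: one_le_power)
  have s2: "s\<^sup>2 = z\<^sup>2 - 1" unfolding s_def using gz g1 by simp
  have s0: "0 \<le> s" unfolding s_def using gz g1 by simp
  have sg: "sqrt (g\<^sup>2 - 1) \<le> s" unfolding s_def using gz by simp
  define x where "x = sgn z * (\<bar>z\<bar> + s)"
  have x0: "x \<noteq> 0" unfolding x_def using z1 s0 by (auto simp: sgn_0_0)
  have sgn2: "sgn z * sgn z = 1" using z1 by (cases "z > 0") auto
  have xabs: "\<bar>x\<bar> = \<bar>z\<bar> + s" unfolding x_def using z1 s0 by (auto simp: abs_mult sgn_if)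
  have "x * (sgn z * (\<bar>z\<bar> - s)) = (sgn z * sgn z) * (\<bar>z\<bar>\<^sup>2 - s\<^sup>2)"
    unfolding x_def by (simp add: algebra_simps power2_eq_square)
  also have "\<dots> = 1" using sgn2 s2 by simp
  finally have inv: "1 / x = sgn z * (\<bar>z\<bar> - s)" using x0 by (simp add: field_simps)
  have "x + 1 / x = 2 * (sgn z * \<bar>z\<bar>)" unfolding inv by (simp add: x_def algebra_simps)
  then have zx: "z = (x + 1 / x) / 2" by (simp add: sgn_mult_abs)
  have "x ^ n + (1 / x) ^ n = x ^ n * (1 + ((1 / x) ^ n)\<^sup>2)"
    using x0 by (simp add: field_simps power2_eq_square)
  then have "\<bar>x ^ n + (1 / x) ^ n\<bar> = \<bar>x\<bar> ^ n * (1 + ((1 / x) ^ n)\<^sup>2)"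
    by (simp add: abs_mult power_abs)
  also have "\<dots> \<ge> \<bar>x\<bar> ^ n * 1" by (intro mult_left_mono) auto
  finally have "\<bar>x\<bar> ^ n \<le> \<bar>x ^ n + (1 / x) ^ n\<bar>" by simp
  moreover have "(g + sqrt (g\<^sup>2 - 1)) ^ n \<le> \<bar>x\<bar> ^ n"
    unfolding xabs using assms sg g1 by (intro power_mono add_mono) auto
  ultimately show ?thesis
    using poly_chebyshev_joukowski[OF x0, of n] unfolding zx[symmetric] by simp
qed

text \<open>
  For \<open>b \<noteq> 0\<close> the hypothesis places the pole \<open>z = - a / b\<close> at distance at least \<open>g\<close> from the origin. The
  polynomial \<open>q = 1 - T / T(z)\<close> has a zero at \<open>z\<close>, so it may be divided by \<open>a + b t\<close>; the
  quotient misses \<open>1 / (a + b t)\<close> by exactly \<open>T(t) / (T(z) (a + b t))\<close>. The division lowers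
  the degree by one, hence the strict bound \<open>degree p < n\<close>.
\<close>

lemma reciprocal_affine_approx_by_poly:
  assumes g: "1 < g" and ab: "\<bar>b\<bar> * g \<le> a" "0 < a" and n: "0 < n"
  obtains p :: "real poly" where "degree p < n"
    "\<And>t. t \<in> {-1..1} \<Longrightarrow>
       \<bar>1 / (a + b * t) - poly p t\<bar> \<le> 2 / ((g + sqrt (g\<^sup>2 - 1)) ^ n * (a - \<bar>b\<bar>))"
proof (cases "b = 0")
  case True
  have g1: "1 \<le> g\<^sup>2" using g by (simp add: one_le_power)
  show ?thesis
    by (rule that[of "[:1 / a:]"]) (use n True ab g g1 in auto)
next
  case False
  define r where "r = g + sqrt (g\<^sup>2 - 1)"
  have g1: "1 \<le> g\<^sup>2" using g by (simp add: one_le_power)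
  have r1: "0 < r" unfolding r_def using g g1 by (simp add: add_pos_nonneg)
  have bpos: "0 < \<bar>b\<bar>" using False by simp
  have "\<bar>b\<bar> * 1 < \<bar>b\<bar> * g" using bpos g by (intro mult_strict_left_mono)
  then have ba: "\<bar>b\<bar> < a" using ab by linarith
  define z where "z = - a / b"
  have gz: "g \<le> \<bar>z\<bar>" unfolding z_def using ab bpos by (simp add: field_simps)
  define T where "T = chebyshev_poly n"
  have Tz: "r ^ n / 2 \<le> \<bar>poly T z\<bar>"
    unfolding T_def r_def by (rule abs_poly_chebyshev_ge[OF g gz])
  have rn: "0 < r ^ n" using r1 by simp
  have Tz0: "poly T z \<noteq> 0" using Tz rn by auto
  define q where "q = 1 - smult (1 / poly T z) T"
  have "poly q z = 0" unfolding q_def using Tz0 by simp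
  then obtain s where s: "q = [:- z, 1:] * s" by (auto simp: poly_eq_0_iff_dvd dvd_def)
  have degq: "degree q \<le> n"
    unfolding q_def T_def using degree_chebyshev_poly[of n]
    by (intro degree_diff_le) (auto intro: order_trans[OF degree_smult_le])
  have degs: "degree s < n"
  proof (cases "s = 0")
    case False
    then have "degree q = 1 + degree s" unfolding s by (subst degree_mult_eq) auto
    with degq show ?thesis by simp
  qed (use n in simp)
  show ?thesis
  proof (rule that[of "smult (1 / b) s"])
    show "degree (smult (1 / b) s) < n" using degs by simp
    fix t :: real assume t: "t \<in> {-1..1}"
    have "\<bar>b * t\<bar> \<le> \<bar>b\<bar>" using t mult_left_mono[of "\<bar>t\<bar>" 1 "\<bar>b\<bar>"] by (auto simp: abs_mult abs_le_iff)
    then have den: "a - \<bar>b\<bar> \<le> a + b * t" by linarith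
    then have den0: "0 < a + b * t" using ba by linarith
    have fac: "a + b * t = b * (t - z)" unfolding z_def using False by (simp add: field_simps)
    have qt: "(t - z) * poly s t = 1 - poly T t / poly T z"
      using arg_cong[OF s, of "\<lambda>p. poly p t"] unfolding q_def by (simp add: algebra_simps)
    have "(1 / (a + b * t) - poly (smult (1 / b) s) t) * (a + b * t)
        = 1 - (t - z) * poly s t"
    proof -
      have "poly (smult (1 / b) s) t * (a + b * t) = (t - z) * poly s t"
        unfolding fac using False by simp
      then show ?thesis using den0 by (simp add: left_diff_distrib)
    qed
    also have "\<dots> = poly T t / poly T z" unfolding qt by simp
    finally have "1 / (a + b * t) - poly (smult (1 / b) s) t
        = poly T t / poly T z / (a + b * t)"
      by (rule iffD2[OF nonzero_eq_divide_eq, rotated]) (use den0 in simp)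
    then have "\<bar>1 / (a + b * t) - poly (smult (1 / b) s) t\<bar>
        = \<bar>poly T t\<bar> / (\<bar>poly T z\<bar> * (a + b * t))"
      using den0 by (simp add: abs_mult)
    also have "\<dots> \<le> 1 / ((r ^ n / 2) * (a - \<bar>b\<bar>))"
      using abs_poly_chebyshev_le_1[of t n] t Tz den ba rn
      unfolding T_def by (intro frac_le mult_mono mult_pos_pos) auto
    finally show "\<bar>1 / (a + b * t) - poly (smult (1 / b) s) t\<bar>
        \<le> 2 / ((g + sqrt (g\<^sup>2 - 1)) ^ n * (a - \<bar>b\<bar>))"
      unfolding r_def by simp
  qed
qed

section \<open>Gauss rules and polynomial approximation\<close>

lemma gauss_rule_has_integral_weight:
  assumes "gauss_rule \<omega> k \<theta> w" "1 \<le> k"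
  shows "(\<omega> has_integral (\<Sum>j=1..k. w j)) {-1..1}"
proof -
  have "\<forall>p :: real poly. degree p < 2 * k \<longrightarrow>
      ((\<lambda>t. \<omega> t * poly p t) has_integral (\<Sum>j=1..k. w j * poly p (\<theta> j))) {-1..1}"
    using assms(1) unfolding gauss_rule_def by blast
  from this[rule_format, of 1] assms(2) show ?thesis by simp
qed

text \<open>
  Exactness on polynomials makes the error of \<open>f\<close> equal to the error of \<open>f - p\<close>. Since the
  weights are nonnegative and sum to the total mass \<open>\<mu>\<close>, the integral and the quadrature sum
  of \<open>f - p\<close> are each at most \<open>\<mu> * e\<close> in absolute value.
\<close>

lemma gauss_rule_error_le:
  assumes gauss: "gauss_rule \<omega> k \<theta> w" and k: "1 \<le> k"
    and nonneg: "\<And>t. t \<in> {-1..1} \<Longrightarrow> 0 \<le> \<omega> t"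
    and mass: "(\<omega> has_integral \<mu>) {-1..1}"
    and f: "((\<lambda>t. \<omega> t * f t) has_integral I) {-1..1}"
    and p: "degree p < 2 * k" "\<And>t. t \<in> {-1..1} \<Longrightarrow> \<bar>f t - poly p t\<bar> \<le> e"
  shows "\<bar>I - (\<Sum>j=1..k. w j * f (\<theta> j))\<bar> \<le> 2 * \<mu> * e"
proof -
  have nodes: "\<theta> j \<in> {-1..1}" "0 \<le> w j" if "j \<in> {1..k}" for j
    using gauss that unfolding gauss_rule_def by (auto simp: less_imp_le)
  have exact: "((\<lambda>t. \<omega> t * poly q t) has_integral (\<Sum>j=1..k. w j * poly q (\<theta> j))) {-1..1}"
    if "degree q < 2 * k" for q
    using gauss that unfolding gauss_rule_def by blast
  have mu: "\<mu> = (\<Sum>j=1..k. w j)"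
    using gauss_rule_has_integral_weight[OF gauss k] mass has_integral_unique by blast
  let ?P = "\<Sum>j=1..k. w j * poly p (\<theta> j)"
  have diff: "((\<lambda>t. \<omega> t * (f t - poly p t)) has_integral (I - ?P)) {-1..1}"
    using has_integral_diff[OF f exact[OF p(1)]] by (simp add: algebra_simps)
  have up: "((\<lambda>t. \<omega> t * e) has_integral (\<mu> * e)) {-1..1}"
    using has_integral_mult_left[OF mass] by simp
  have pw: "\<bar>\<omega> t * (f t - poly p t)\<bar> \<le> \<omega> t * e" if "t \<in> {-1..1}" for t
    using p(2)[OF that] nonneg[OF that] by (simp add: abs_mult mult_left_mono)
  have "I - ?P \<le> \<mu> * e"
    by (rule has_integral_le[OF diff up]) (use pw in \<open>auto simp: abs_le_iff\<close>)
  moreover have "- (I - ?P) \<le> \<mu> * e"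
    by (rule has_integral_le[OF has_integral_neg[OF diff] up]) (use pw in \<open>auto simp: abs_le_iff\<close>)
  ultimately have 1: "\<bar>I - ?P\<bar> \<le> \<mu> * e" by linarith
  have "\<bar>?P - (\<Sum>j=1..k. w j * f (\<theta> j))\<bar> = \<bar>\<Sum>j=1..k. w j * (poly p (\<theta> j) - f (\<theta> j))\<bar>"
    by (simp add: sum_subtractf algebra_simps)
  also have "\<dots> \<le> (\<Sum>j=1..k. \<bar>w j * (poly p (\<theta> j) - f (\<theta> j))\<bar>)" by (rule sum_abs)
  also have "\<dots> \<le> (\<Sum>j=1..k. w j * e)"
    using nodes p(2) by (intro sum_mono) (simp add: abs_mult abs_minus_commute mult_left_mono)
  also have "\<dots> = \<mu> * e" unfolding mu by (simp add: sum_distrib_right)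
  finally show ?thesis using 1 by linarith
qed

section \<open>The integral representation of a fractional power\<close>

lemma Beta_reflection_real:
  fixes b :: real
  shows "Beta b (1 - b) = pi / sin (b * pi)"
proof -
  have "complex_of_real (Gamma b * Gamma (1 - b)) = complex_of_real (pi / sin (b * pi))"
    using Gamma_reflection_complex[of "of_real b"]
    by (simp add: Gamma_complex_of_real[symmetric] sin_of_real[symmetric] mult.commute)
  then have "Gamma b * Gamma (1 - b) = pi / sin (b * pi)" by (simp only: of_real_eq_iff)
  then show ?thesis by (simp add: Beta_def)
qed

text \<open>
  The Moebius map \<open>s(t) = \<tau> (1 - t) / D(t)\<close>, with \<open>D(t) = \<tau> (1 - t) + l (1 + t)\<close>, sends
  \<open>[-1,1]\<close> onto \<open>[0,1]\<close> reversing the orientation, with \<open>1 - s(t) = l (1 + t) / D(t)\<close> and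
  \<open>s'(t) = - 2 \<tau> l / D(t)\<^sup>2\<close>. It turns the integral of
  \<open>s powr (b - 1) * (1 - s) powr (- b)\<close> into a multiple of the given one. The integrands may be
  unbounded at the end points, so the substitution is carried out on antiderivatives: these are
  continuous on the closed interval and differentiable in its interior.
\<close>

lemma has_integral_jacobi_resolvent:
  assumes b: "0 < b" "b < 1" and "0 < \<tau>" "0 < l"
  shows "((\<lambda>t. jacobi_weight b t * (1 / (\<tau> * (1 - t) + l * (1 + t)))) has_integral
      pi / sin (b * pi) * l powr (b - 1) / (2 * \<tau> powr b)) {-1..1}"
proof -
  define g where "g = (\<lambda>s::real. s powr (b - 1) * (1 - s) powr ((1 - b) - 1))"
  define F where "F = (\<lambda>u. integral {0..u} g)"
  define D where "D = (\<lambda>t. \<tau> * (1 - t) + l * (1 + t))"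
  define s where "s = (\<lambda>t. \<tau> * (1 - t) / D t)"
  define c where "c = l powr (b - 1) / (2 * \<tau> powr b)"
  have gint: "(g has_integral Beta b (1 - b)) {0..1}"
    unfolding g_def using b by (intro has_integral_Beta_real) auto
  then have gi: "g integrable_on {0..1}" by blast
  have D0: "0 < D t" if "t \<in> {-1..1}" for t
  proof (cases "t = 1")
    case False
    then have "0 < \<tau> * (1 - t)" "0 \<le> l * (1 + t)" using that assms by auto
    then show ?thesis unfolding D_def by linarith
  qed (use assms in \<open>simp add: D_def\<close>)
  have s01: "s t \<in> {0..1}" if "t \<in> {-1..1}" for t
    using D0[OF that] that assms unfolding s_def D_def by (auto simp: divide_le_eq_1)
  have "continuous_on {0..1} F" unfolding F_def by (rule indefinite_integral_continuous_1[OF gi])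
  moreover have "continuous_on {-1..1} s"
    unfolding s_def using D0 unfolding D_def by (intro continuous_intros) force
  ultimately have cont: "continuous_on {-1..1} (\<lambda>t. - c * F (s t))"
    using s01 by (intro continuous_intros continuous_on_compose2[where g = F and f = s]) auto
  have der: "((\<lambda>t. - c * F (s t)) has_real_derivative jacobi_weight b t * (1 / D t)) (at t)"
    if t: "t \<in> {-1<..<1}" for t
  proof -
    have Dt: "0 < D t" using D0 t by simp
    have p: "0 < 1 - t" "0 < 1 + t" using t by auto
    have st: "0 < s t" unfolding s_def using Dt p assms by simp
    have s1: "1 - s t = l * (1 + t) / D t"
      unfolding s_def using Dt by (simp add: field_simps) (simp add: D_def algebra_simps)
    have st1: "0 < 1 - s t" unfolding s1 using Dt p assms by simp
    have "isCont g (s t)"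
      unfolding g_def using st st1 by (intro continuous_intros) auto
    then have "(F has_vector_derivative g (s t)) (at (s t) within ({0..1} - {}))"
      unfolding F_def using st st1
      by (intro integral_has_vector_derivative_continuous_at[OF gi]) (auto intro: continuous_at_imp_continuous_at_within)
    then have "(F has_real_derivative g (s t)) (at (s t) within {0..1})"
      by (simp add: has_real_derivative_iff_has_vector_derivative)
    moreover have "at (s t) within {0..1} = at (s t)"
      using st st1 by (intro at_within_interior) auto
    ultimately have F': "(F has_real_derivative g (s t)) (at (s t))" by simp
    have s': "(s has_real_derivative (- 2 * \<tau> * l / (D t)\<^sup>2)) (at t)"
      unfolding s_def D_def using Dt unfolding D_def
      by (auto intro!: derivative_eq_intros simp: field_simps power2_eq_square)
    have d: "((\<lambda>t. - c * F (s t)) has_real_derivative - c * (g (s t) * (- 2 * \<tau> * l / (D t)\<^sup>2))) (at t)"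
      by (intro DERIV_cmult DERIV_chain2[OF F' s'])
    have "g (s t) = (\<tau> * (1 - t) / D t) powr (b - 1) * (l * (1 + t) / D t) powr (- b)"
      unfolding g_def s1 by (simp add: s_def)
    also have "\<dots> = \<tau> powr (b - 1) * l powr (- b) * jacobi_weight b t
        / (D t powr (b - 1) * D t powr (- b))"
      unfolding jacobi_weight_def using p assms Dt by (simp add: powr_mult powr_divide)
    also have "D t powr (b - 1) * D t powr (- b) = 1 / D t"
      using powr_add[of "D t" "b - 1" "- b", symmetric] powr_minus_divide[of "D t" 1] Dt by simp
    finally have gs: "g (s t) = \<tau> powr (b - 1) * l powr (- b) * jacobi_weight b t * D t" by simp
    (* c is the constant for which the factors coming from g and from the derivative of s cancel. *)
    have "c * (\<tau> powr (b - 1) * l powr (- b)) * (2 * \<tau> * l) = 1"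
    proof -
      have "\<tau> powr (b - 1) = \<tau> powr b / \<tau>" "l powr (b - 1) = l powr b / l" "l powr (-b) = 1 / l powr b"
        using assms by (simp_all add: powr_diff powr_minus_divide)
      then show ?thesis unfolding c_def using assms by simp
    qed
    then have cc: "c * (\<tau> powr (b - 1) * l powr (- b)) * (2 * \<tau> * l) * x = x" for x by simp
    have "- c * (g (s t) * (- 2 * \<tau> * l / (D t)\<^sup>2))
       = c * (\<tau> powr (b - 1) * l powr (- b)) * (2 * \<tau> * l) * (jacobi_weight b t * (D t / (D t)\<^sup>2))"
      unfolding gs by (simp add: algebra_simps)
    also have "\<dots> = jacobi_weight b t * (D t / (D t)\<^sup>2)" by (rule cc)
    also have "D t / (D t)\<^sup>2 = 1 / D t" using Dt by (simp add: power2_eq_square)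
    finally show ?thesis using d by simp
  qed
  have "((\<lambda>t. jacobi_weight b t * (1 / D t)) has_integral
      (- c * F (s 1) - - c * F (s (- 1)))) {-1..1}"
    by (intro fundamental_theorem_of_calculus_interior cont)
       (use der in \<open>auto simp: has_real_derivative_iff_has_vector_derivative\<close>)
  moreover have "F (s 1) = 0" "F (s (- 1)) = pi / sin (b * pi)"
    using assms integral_unique[OF gint] unfolding F_def s_def D_def
    by (simp_all add: Beta_reflection_real)
  ultimately show ?thesis unfolding D_def c_def by (simp add: mult.commute)
qed


section \<open>Orthonormal eigenbases of symmetric matrices\<close>

lemma linear_term_eq_0_if_quadratic_nonneg:
  fixes a c :: real
  assumes "\<And>t. 0 \<le> a * t + c * t\<^sup>2"
  shows "a = 0"
proof -
  define d where "d = \<bar>c\<bar> + 1"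
  have d: "0 < d" "c < d" unfolding d_def by auto
  (* d exceeds c and is positive, so the quadratic is negative at - a / d unless a = 0. *)
  have "0 \<le> a * (- a / d) + c * (- a / d)\<^sup>2" by (rule assms)
  also have "\<dots> = a\<^sup>2 * (c - d) / d\<^sup>2" using d by (simp add: field_simps power2_eq_square)
  finally have "0 \<le> a\<^sup>2 * (c - d)" using d by (simp add: zero_le_divide_iff)
  then show ?thesis using d by (simp add: zero_le_mult_iff)
qed

lemma symmetric_matrix_inner:
  fixes A :: "real^'n^'n"
  assumes "transpose A = A"
  shows "x \<bullet> (A *v y) = (A *v x) \<bullet> y"
  using assms by (metis dot_lmul_matrix vector_transpose_matrix)

text \<open>
  A maximiser \<open>u\<close> of the Rayleigh quotient on the unit sphere of the subspace is an eigenvector.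
  With the maximum \<open>m\<close>, the quadratic form of \<open>m I - A\<close> is nonnegative on the subspace and
  vanishes at \<open>u\<close>. Moving from \<open>u\<close> in the direction of the residual \<open>v = m u - A u\<close>, which
  stays in the subspace, changes the form to first order by \<open>2 (v \<bullet> v)\<close>, so \<open>v = 0\<close>.
\<close>

lemma symmetric_matrix_eigenvector_in_invariant_subspace:
  fixes A :: "real^'n^'n"
  assumes sym: "transpose A = A" and S: "subspace S" and inv: "\<And>x. x \<in> S \<Longrightarrow> A *v x \<in> S"
    and nz: "x0 \<in> S" "x0 \<noteq> 0"
  obtains u m where "u \<in> S" "norm u = 1" "A *v u = m *\<^sub>R u"
proof -
  let ?K = "S \<inter> sphere 0 1"
  have K: "compact ?K" using S by (simp add: closed_subspace closed_Int_compact)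
  have "(1 / norm x0) *\<^sub>R x0 \<in> ?K" using nz S by (simp add: subspace_scale)
  then have ne: "?K \<noteq> {}" by blast
  have lin: "bounded_linear (\<lambda>x. A *v x)" by (rule matrix_vector_mul_bounded_linear)
  have "continuous_on ?K (\<lambda>x. x \<bullet> (A *v x))"
    by (intro continuous_intros linear_continuous_on lin)
  then obtain u where u: "u \<in> ?K" and max: "\<And>y. y \<in> ?K \<Longrightarrow> y \<bullet> (A *v y) \<le> u \<bullet> (A *v u)"
    using continuous_attains_sup[OF K ne] by blast
  define m where "m = u \<bullet> (A *v u)"
  have uS: "u \<in> S" and u1: "norm u = 1" using u by auto
  have ray: "0 \<le> m * (y \<bullet> y) - y \<bullet> (A *v y)" if "y \<in> S" for y
  proof (cases "y = 0")
    case False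
    then have "(1 / norm y) *\<^sub>R y \<in> ?K" using that S by (simp add: subspace_scale)
    from max[OF this] have "(y \<bullet> (A *v y)) / (norm y)\<^sup>2 \<le> m"
      unfolding m_def by (simp add: matrix_vector_mult_scaleR power2_eq_square)
    then show ?thesis using False by (simp add: field_simps power2_norm_eq_inner)
  qed simp
  define v where "v = m *\<^sub>R u - A *v u"
  have vS: "v \<in> S" unfolding v_def using S uS inv by (simp add: subspace_diff subspace_scale)
  have "0 \<le> 2 * (v \<bullet> v) * t + (m * (v \<bullet> v) - v \<bullet> (A *v v)) * t\<^sup>2" for t
  proof -
    have "u + t *\<^sub>R v \<in> S" using S uS vS by (simp add: subspace_add subspace_scale)
    from ray[OF this]
    have "0 \<le> m * ((u + t *\<^sub>R v) \<bullet> (u + t *\<^sub>R v))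
        - (u + t *\<^sub>R v) \<bullet> (A *v u + t *\<^sub>R (A *v v))"
      by (simp add: matrix_vector_right_distrib matrix_vector_mult_scaleR)
    also have "\<dots> = (m * (u \<bullet> u) - u \<bullet> (A *v u))
        + t * (2 * m * (u \<bullet> v) - u \<bullet> (A *v v) - v \<bullet> (A *v u))
        + (m * (v \<bullet> v) - v \<bullet> (A *v v)) * t\<^sup>2"
      by (simp add: inner_add_left inner_add_right inner_commute algebra_simps power2_eq_square)
    also have "m * (u \<bullet> u) - u \<bullet> (A *v u) = 0"
      using u1 unfolding m_def by (simp add: norm_eq_1)
    also have "2 * m * (u \<bullet> v) - u \<bullet> (A *v v) - v \<bullet> (A *v u) = 2 * (v \<bullet> v)"
    proof -
      have "u \<bullet> (A *v v) = v \<bullet> (A *v u)"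
        using symmetric_matrix_inner[OF sym, of u v] by (simp add: inner_commute)
      moreover have "v \<bullet> v = m * (u \<bullet> v) - v \<bullet> (A *v u)"
        by (subst (2) v_def) (simp add: inner_diff_right inner_commute)
      ultimately show ?thesis by simp
    qed
    finally show ?thesis by (simp add: mult.commute)
  qed
  then have "2 * (v \<bullet> v) = 0" by (rule linear_term_eq_0_if_quadratic_nonneg)
  then have "A *v u = m *\<^sub>R u" unfolding v_def by simp
  with uS u1 show ?thesis by (rule that)
qed

text \<open>
  The orthogonal complement of a set of eigenvectors of a symmetric matrix is invariant, so as long
  as it is nonzero it contributes a further eigenvector.
\<close>

lemma symmetric_matrix_orthonormal_eigenvectors:
  fixes A :: "real^'n^'n"
  assumes sym: "transpose A = A" and "k \<le> CARD('n)"
  shows "\<exists>B. finite B \<and> card B = k \<and> pairwise orthogonal B \<and>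
      (\<forall>b\<in>B. norm b = 1 \<and> (\<exists>m. A *v b = m *\<^sub>R b))"
  using assms(2)
proof (induction k)
  case 0
  then show ?case by (intro exI[of _ "{}"]) auto
next
  case (Suc k)
  then obtain B where B: "finite B" "card B = k" "pairwise orthogonal B"
    "\<And>b. b \<in> B \<Longrightarrow> norm b = 1" "\<And>b. b \<in> B \<Longrightarrow> \<exists>m. A *v b = m *\<^sub>R b"
    by (metis Suc_leD)
  define S where "S = {x. \<forall>b\<in>B. orthogonal b x}"
  have S: "subspace S"
    unfolding S_def by (auto simp: subspace_def orthogonal_def inner_add_right)
  have inv: "A *v x \<in> S" if "x \<in> S" for x
    unfolding S_def
  proof (intro CollectI ballI)
    fix b assume b: "b \<in> B"
    then obtain m where "A *v b = m *\<^sub>R b" using B(5) by blast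
    then show "orthogonal b (A *v x)"
      using that b unfolding S_def orthogonal_def symmetric_matrix_inner[OF sym] by simp
  qed
  have "dim B < DIM(real^'n)" using dim_le_card'[OF B(1)] B(2) Suc.prems by simp
  then obtain x0 where "x0 \<noteq> 0" "\<And>y. y \<in> span B \<Longrightarrow> orthogonal x0 y"
    using orthogonal_to_subspace_exists by blast
  then have x0: "x0 \<in> S" "x0 \<noteq> 0" unfolding S_def by (auto simp: orthogonal_commute span_base)
  obtain u m where u: "u \<in> S" "norm u = 1" "A *v u = m *\<^sub>R u"
    by (rule symmetric_matrix_eigenvector_in_invariant_subspace[OF sym S inv x0])
  have "u \<notin> B" using u(1,2) unfolding S_def by (auto simp: orthogonal_def norm_eq_1)
  moreover have "pairwise orthogonal (insert u B)"
    using B(3) u(1) unfolding S_def pairwise_insert by (auto simp: orthogonal_commute)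
  ultimately show ?case
    using B u by (intro exI[of _ "insert u B"]) auto
qed

section \<open>Functions of a matrix in an orthonormal eigenbasis\<close>

text \<open>
  For orthogonal \<open>Q\<close> this is \<open>M = Q D Q\<^sup>T\<close> with \<open>D\<close> the diagonal matrix of \<open>d\<close> (lemma
  \<open>diagonalized_by_iff\<close>). Stated column by column, it passes to sums, products and inverses without
  matrix manipulations.
\<close>

definition diagonalized_by :: "real^'n^'n \<Rightarrow> real^'n^'n \<Rightarrow> ('n \<Rightarrow> real) \<Rightarrow> bool" where
  "diagonalized_by Q M d \<longleftrightarrow> (\<forall>i. M *v column i Q = d i *\<^sub>R column i Q)"

lemma symmetric_matrix_diagonalizable:
  fixes A :: "real^'n^'n"
  assumes sym: "transpose A = A"
  obtains Q d where "orthogonal_matrix Q" "diagonalized_by Q A d"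
proof -
  obtain B where B: "finite B" "card B = CARD('n)" "pairwise orthogonal B"
    "\<forall>b\<in>B. norm b = 1 \<and> (\<exists>m. A *v b = m *\<^sub>R b)"
    using symmetric_matrix_orthonormal_eigenvectors[OF sym order_refl] by blast
  obtain v where v: "bij_betw v (UNIV :: 'n set) B"
    using finite_same_card_bij[OF finite B(1)] B(2) by auto
  have vB: "v i \<in> B" for i using v by (auto simp: bij_betw_def)
  have vinj: "v i \<noteq> v j" if "i \<noteq> j" for i j
    using v that by (auto simp: bij_betw_def inj_on_def)
  define Q :: "real^'n^'n" where "Q = (\<chi> i j. v j $ i)"
  have col: "column i Q = v i" for i unfolding Q_def column_def by (simp add: vec_eq_iff)
  have Q: "orthogonal_matrix Q"
    unfolding orthogonal_matrix_orthonormal_columns col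
    using B(3,4) vB vinj by (auto simp: pairwise_def)
  have "\<forall>i. \<exists>m. A *v v i = m *\<^sub>R v i" using B(4) vB by blast
  from choice[OF this] obtain d where "\<forall>i. A *v v i = d i *\<^sub>R v i" ..
  then have "diagonalized_by Q A d" unfolding diagonalized_by_def col .
  with Q show ?thesis by (rule that)
qed

lemma diagonalized_by_mat_1: "diagonalized_by Q (mat 1) (\<lambda>_. 1)"
  by (simp add: diagonalized_by_def)

lemma diagonalized_by_add:
  "diagonalized_by Q M d \<Longrightarrow> diagonalized_by Q N e \<Longrightarrow> diagonalized_by Q (M + N) (\<lambda>i. d i + e i)"
  by (simp add: diagonalized_by_def matrix_vector_mult_add_rdistrib scaleR_add_left)

lemma diagonalized_by_diff:
  "diagonalized_by Q M d \<Longrightarrow> diagonalized_by Q N e \<Longrightarrow> diagonalized_by Q (M - N) (\<lambda>i. d i - e i)"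
  by (simp add: diagonalized_by_def matrix_vector_mult_diff_rdistrib scaleR_diff_left)

lemma diagonalized_by_scaleR:
  "diagonalized_by Q M d \<Longrightarrow> diagonalized_by Q (c *\<^sub>R M) (\<lambda>i. c * d i)"
  by (simp add: diagonalized_by_def scaleR_matrix_vector_assoc[symmetric])

lemma diagonalized_by_sum:
  assumes "\<And>j. j \<in> J \<Longrightarrow> diagonalized_by Q (M j) (d j)"
  shows "diagonalized_by Q (\<Sum>j\<in>J. M j) (\<lambda>i. \<Sum>j\<in>J. d j i)"
  using assms
proof (induction J rule: infinite_finite_induct)
  case (insert j J)
  then show ?case by (simp add: diagonalized_by_add)
qed (simp_all add: diagonalized_by_def)

lemma diagonalized_by_mult:
  "diagonalized_by Q M d \<Longrightarrow> diagonalized_by Q N e \<Longrightarrow> diagonalized_by Q (M ** N) (\<lambda>i. d i * e i)"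
  by (simp add: diagonalized_by_def matrix_vector_mul_assoc[symmetric] matrix_vector_mult_scaleR mult.commute)

lemma diag_matrix_mult_vec: "diag_matrix d *v y = (\<chi> i. d $ i * y $ i)"
  by (simp add: diag_matrix_def matrix_vector_mult_def vec_eq_iff if_distrib[of "\<lambda>c. c * _"] cong: if_cong)

lemma diag_matrix_mult_axis: "diag_matrix d *v axis i 1 = d $ i *\<^sub>R axis i 1"
  by (simp add: diag_matrix_mult_vec axis_def vec_eq_iff)

lemma diagonalized_by_iff:
  assumes Q: "orthogonal_matrix Q"
  shows "diagonalized_by Q M (\<lambda>i. d $ i) \<longleftrightarrow> M = Q ** diag_matrix d ** transpose Q"
proof -
  have QQ: "transpose Q ** Q = mat 1" "Q ** transpose Q = mat 1"
    using Q by (auto simp: orthogonal_matrix_def)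
  have col: "column i Q = Q *v axis i 1" for i by (simp add: matrix_vector_mult_basis)
  have ax: "(M ** Q) *v axis i 1 = M *v column i Q"
      "(Q ** diag_matrix d) *v axis i 1 = d $ i *\<^sub>R column i Q" for i
    by (simp_all add: col matrix_vector_mul_assoc[symmetric] diag_matrix_mult_axis matrix_vector_mult_scaleR)
  have "diagonalized_by Q M (\<lambda>i. d $ i) \<longleftrightarrow> M ** Q = Q ** diag_matrix d"
    unfolding diagonalized_by_def ax[symmetric]
    by (auto simp: matrix_vector_mult_basis column_def vec_eq_iff)
  also have "\<dots> \<longleftrightarrow> M = Q ** diag_matrix d ** transpose Q"
    using QQ by (metis matrix_mul_assoc matrix_mul_rid)
  finally show ?thesis .
qed

lemma diagonalized_by_unique:
  assumes "orthogonal_matrix Q" "diagonalized_by Q M d" "diagonalized_by Q N d"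
  shows "M = N"
  using diagonalized_by_iff[OF assms(1), of M "\<chi> i. d i"]
    diagonalized_by_iff[OF assms(1), of N "\<chi> i. d i"] assms(2,3) by simp

lemma diagonalized_by_matrix_inv:
  assumes Q: "orthogonal_matrix Q" and M: "diagonalized_by Q M d" and nz: "\<And>i. d i \<noteq> 0"
  shows "diagonalized_by Q (matrix_inv M) (\<lambda>i. 1 / d i)"
proof -
  define N where "N = Q ** diag_matrix (\<chi> i. 1 / d i) ** transpose Q"
  have N: "diagonalized_by Q N (\<lambda>i. 1 / d i)"
    using diagonalized_by_iff[OF Q, of N "\<chi> i. 1 / d i"] N_def by simp
  have MN: "M ** N = mat 1"
    using diagonalized_by_unique[OF Q _ diagonalized_by_mat_1] diagonalized_by_mult[OF M N] nz by simp
  then have NM: "N ** M = mat 1" by (rule matrix_left_right_inverse1)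
  have "M ** matrix_inv M = mat 1 \<and> matrix_inv M ** M = mat 1"
    unfolding matrix_inv_def by (rule someI[of _ N]) (use MN NM in simp)
  then have "matrix_inv M = N" using NM by (metis matrix_mul_assoc matrix_mul_lid matrix_mul_rid)
  with N show ?thesis by simp
qed

text \<open>
  This includes the independence of the power from the diagonalisation that the definite description
  in \<open>matrix_powr\<close> relies on. If \<open>A = P E P\<^sup>T\<close> is another one, then an eigenvector of \<open>A\<close> for
  \<open>l\<close> has in the basis \<open>P\<close> only coordinates at which \<open>E\<close> has the entry \<open>l\<close>. Hence
  \<open>P E\<^sup>b P\<^sup>T\<close> multiplies it by \<open>l powr b\<close>, whatever \<open>P\<close> and \<open>E\<close> are; applied to the columns of
  \<open>Q\<close> this determines the matrix.
\<close>

lemma diagonalized_by_matrix_powr: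
  assumes Q: "orthogonal_matrix Q" and A: "diagonalized_by Q A d"
  shows "diagonalized_by Q (matrix_powr A b) (\<lambda>i. d i powr b)"
proof -
  define B where "B = Q ** diag_matrix (\<chi> i. (\<chi> i. d i) $ i powr b) ** transpose Q"
  have dB: "diagonalized_by Q B (\<lambda>i. d i powr b)"
    using diagonalized_by_iff[OF Q, of B "\<chi> i. d i powr b"] unfolding B_def by simp
  have AQ: "A = Q ** diag_matrix (\<chi> i. d i) ** transpose Q"
    using diagonalized_by_iff[OF Q, of A "\<chi> i. d i"] A by simp
  have "matrix_powr A b = B"
    unfolding matrix_powr_def
  proof (rule the_equality)
    show "\<exists>Q d. orthogonal_matrix Q \<and> A = Q ** diag_matrix d ** transpose Q
        \<and> B = Q ** diag_matrix (\<chi> i. (d $ i) powr b) ** transpose Q"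
      using Q AQ B_def by blast
  next
    fix B' assume "\<exists>Q d. orthogonal_matrix Q \<and> A = Q ** diag_matrix d ** transpose Q
        \<and> B' = Q ** diag_matrix (\<chi> i. (d $ i) powr b) ** transpose Q"
    then obtain P e where P: "orthogonal_matrix P" and AP: "A = P ** diag_matrix e ** transpose P"
      and BP: "B' = P ** diag_matrix (\<chi> i. (e $ i) powr b) ** transpose P" by blast
    have PP: "transpose P ** P = mat 1" "P ** transpose P = mat 1"
      using P by (auto simp: orthogonal_matrix_def)
    have "B' *v x = (l powr b) *\<^sub>R x" if x: "A *v x = l *\<^sub>R x" for x l
    proof -
      define y where "y = transpose P *v x"
      have xy: "x = P *v y" unfolding y_def by (simp only: matrix_vector_mul_assoc PP matrix_vector_mul_lid)
      have "diag_matrix e *v y = transpose P *v (A *v x)"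
        unfolding AP y_def matrix_vector_mul_assoc by (simp add: matrix_mul_assoc PP)
      also have "\<dots> = l *\<^sub>R y" unfolding x y_def by (simp add: matrix_vector_mult_scaleR)
      finally have "e $ i * y $ i = l * y $ i" for i
        unfolding diag_matrix_mult_vec by (simp add: vec_eq_iff)
      then have "(e $ i) powr b * y $ i = l powr b * y $ i" for i
        by (metis mult_right_cancel mult_zero_right)
      then have "diag_matrix (\<chi> i. (e $ i) powr b) *v y = (l powr b) *\<^sub>R y"
        unfolding diag_matrix_mult_vec by (simp add: vec_eq_iff)
      moreover have "B' *v x = P *v (diag_matrix (\<chi> i. (e $ i) powr b) *v y)"
        unfolding BP y_def matrix_vector_mul_assoc by (simp add: matrix_mul_assoc)
      ultimately show ?thesis unfolding xy by (simp add: matrix_vector_mult_scaleR)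
    qed
    then have "diagonalized_by Q B' (\<lambda>i. d i powr b)" using A unfolding diagonalized_by_def by blast
    then show "B' = B" using diagonalized_by_unique[OF Q _ dB] by blast
  qed
  with dB show ?thesis by simp
qed

lemma spectral_norm_le_if_diagonalized_by:
  fixes M :: "real^'n^'n"
  assumes Q: "orthogonal_matrix Q" and M: "diagonalized_by Q M d"
    and bound: "\<And>i. \<bar>d i\<bar> \<le> e"
  shows "spectral_norm M \<le> e"
  unfolding spectral_norm_def
proof (rule onorm_le)
  fix x
  define y where "y = transpose Q *v x"
  have MQ: "M = Q ** diag_matrix (\<chi> i. d i) ** transpose Q"
    using diagonalized_by_iff[OF Q, of M "\<chi> i. d i"] M by simp
  have iso: "norm (P *v z) = norm z" if "orthogonal_matrix P" for P :: "real^'n^'n" and z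
    using that orthogonal_transformation_matrix[of "(*v) P"]
    by (simp add: orthogonal_transformation_norm matrix_of_matrix_vector_mul)
  have "M *v x = Q *v (diag_matrix (\<chi> i. d i) *v y)"
    unfolding MQ y_def matrix_vector_mul_assoc by (simp add: matrix_mul_assoc)
  then have "norm (M *v x) = norm (diag_matrix (\<chi> i. d i) *v y)" by (simp add: iso[OF Q])
  also have "diag_matrix (\<chi> i. d i) *v y = (\<chi> i. d i * y $ i)"
    by (simp add: diag_matrix_mult_vec)
  also have "norm \<dots> \<le> norm (e *\<^sub>R y)"
  proof (rule norm_le_componentwise_cart)
    fix i
    have "\<bar>d i\<bar> * \<bar>y $ i\<bar> \<le> e * \<bar>y $ i\<bar>" using bound by (intro mult_right_mono) auto
    also have "\<dots> \<le> \<bar>e\<bar> * \<bar>y $ i\<bar>" by (intro mult_right_mono) auto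
    finally show "norm ((\<chi> i. d i * y $ i) $ i) \<le> norm ((e *\<^sub>R y) $ i)"
      by (simp add: abs_mult)
  qed
  also have "\<dots> = e * norm x"
    using bound[of undefined] iso[of "transpose Q" x] Q unfolding y_def by simp
  finally show "norm (M *v x) \<le> e * norm x" .
qed

text \<open>
  The factor \<open>1 + \<theta> j\<close> that is split between coefficients and shifts is put back into the inverse,
  so that the eigenvalues contain the plain Gauss sum for \<open>1 / (\<tau> (1 - t) + x (1 + t))\<close>.
\<close>

lemma diagonalized_by_gj_approx:
  assumes Q: "orthogonal_matrix Q" and A: "diagonalized_by Q A d" and d: "\<And>i. 0 < d i"
    and \<tau>: "0 < \<tau>" and \<theta>: "\<And>j. j \<in> {1..k} \<Longrightarrow> -1 < \<theta> j \<and> \<theta> j < 1"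
  shows "diagonalized_by Q (gj_approx b \<tau> k \<theta> w A)
      (\<lambda>i. d i * (2 * sin (b * pi) * \<tau> powr b / pi *
         (\<Sum>j=1..k. w j * (1 / (\<tau> * (1 - \<theta> j) + d i * (1 + \<theta> j))))))"
proof -
  have "diagonalized_by Q (gj_approx b \<tau> k \<theta> w A)
      (\<lambda>i. d i * (\<Sum>j=1..k. gj_coeff b \<tau> (w j) (\<theta> j) * (1 / (gj_shift \<tau> (\<theta> j) * 1 + d i))))"
    unfolding gj_approx_def
  proof (intro diagonalized_by_mult diagonalized_by_sum diagonalized_by_scaleR
      diagonalized_by_matrix_inv diagonalized_by_add diagonalized_by_mat_1 A Q)
    fix j i assume "j \<in> {1..k}"
    then have "0 < gj_shift \<tau> (\<theta> j)" unfolding gj_shift_def using \<theta>[of j] \<tau> by simp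
    then show "gj_shift \<tau> (\<theta> j) * 1 + d i \<noteq> 0" using d[of i] by simp
  qed
  moreover have "(\<Sum>j=1..k. gj_coeff b \<tau> (w j) (\<theta> j) * (1 / (gj_shift \<tau> (\<theta> j) * 1 + d i)))
      = 2 * sin (b * pi) * \<tau> powr b / pi *
         (\<Sum>j=1..k. w j * (1 / (\<tau> * (1 - \<theta> j) + d i * (1 + \<theta> j))))" for i
    unfolding sum_distrib_left
  proof (rule sum.cong)
    fix j assume "j \<in> {1..k}"
    then have p: "1 + \<theta> j > 0" using \<theta>[of j] by simp
    have "(1 + \<theta> j) * (gj_shift \<tau> (\<theta> j) * 1 + d i) = \<tau> * (1 - \<theta> j) + d i * (1 + \<theta> j)"
      unfolding gj_shift_def using p by (simp add: field_simps)
    then show "gj_coeff b \<tau> (w j) (\<theta> j) * (1 / (gj_shift \<tau> (\<theta> j) * 1 + d i))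
      = 2 * sin (b * pi) * \<tau> powr b / pi * (w j * (1 / (\<tau> * (1 - \<theta> j) + d i * (1 + \<theta> j))))"
      unfolding gj_coeff_def by (simp flip: \<open>_ = \<tau> * (1 - \<theta> j) + d i * (1 + \<theta> j)\<close>)
  qed simp
  ultimately show ?thesis by simp
qed

section \<open>The error bound\<close>

text \<open>
  The pole of \<open>1 / (\<tau> (1 - t) + x (1 + t))\<close> lies at \<open>(\<tau> + x) / (\<tau> - x)\<close>. It is closest to the
  interval when \<open>x\<close> is extremal, and for the geometric mean \<open>\<tau>\<close> the two extremal poles are
  \<open>\<gamma>\<close> and \<open>- \<gamma>\<close>. The inequality is stated without a division, which covers \<open>x = \<tau>\<close>, where there
  is no pole.
\<close>

lemma geometric_mean_balances_poles:
  assumes l: "0 < lmin" "lmin < lmax" "lmin \<le> x" "x \<le> lmax"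
    and \<tau>: "\<tau> = sqrt (lmin * lmax)"
    and \<gamma>: "\<gamma> = (sqrt (lmax / lmin) + 1) / (sqrt (lmax / lmin) - 1)"
  shows "\<bar>x - \<tau>\<bar> * \<gamma> \<le> x + \<tau>"
proof -
  define p where "p = sqrt lmin"
  define q where "q = sqrt lmax"
  have pq: "0 < p" "p < q" unfolding p_def q_def using l by auto
  have sq: "lmin = p * p" "lmax = q * q" unfolding p_def q_def using l by auto
  have t: "\<tau> = p * q" unfolding \<tau> p_def q_def by (rule real_sqrt_mult)
  have s: "sqrt (lmax / lmin) = q / p" unfolding p_def q_def by (rule real_sqrt_divide)
  have g: "\<gamma> = (q + p) / (q - p)" unfolding \<gamma> s using pq by (simp add: field_simps)
  have "\<bar>x - \<tau>\<bar> * (q + p) \<le> (x + \<tau>) * (q - p)"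
  proof (cases "\<tau> \<le> x")
    case True
    have "x * p \<le> q * q * p" using l(4) pq unfolding sq by (intro mult_right_mono) auto
    then show ?thesis using True unfolding t by (simp add: algebra_simps)
  next
    case False
    have "p * p * q \<le> x * q" using l(3) pq unfolding sq by (intro mult_right_mono) auto
    then show ?thesis using False unfolding t by (simp add: algebra_simps)
  qed
  then show ?thesis unfolding g using pq by (simp add: field_simps)
qed

text \<open>
  For \<open>a = x + \<tau>\<close> and \<open>b = x - \<tau>\<close> the minimum of \<open>a + b t\<close> on \<open>[-1,1]\<close> is
  \<open>a - \<bar>b\<bar> = 2 * min x \<tau>\<close>; this is where the minimum in the bound comes from.
\<close>

lemma scalar_gauss_jacobi_error_le:
  assumes b: "0 < b" "b < 1" and \<tau>: "0 < \<tau>" and x: "0 < x" and k: "1 \<le> k"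
    and gauss: "gauss_rule (jacobi_weight b) k \<theta> w"
    and mass: "(jacobi_weight b has_integral \<mu>) {-1..1}"
    and g: "1 < g" "\<bar>x - \<tau>\<bar> * g \<le> x + \<tau>"
  shows "\<bar>x powr b - x * (2 * sin (b * pi) * \<tau> powr b / pi *
           (\<Sum>j=1..k. w j * (1 / (\<tau> * (1 - \<theta> j) + x * (1 + \<theta> j)))))\<bar>
    \<le> x * (2 * sin (b * pi) * \<tau> powr b / pi) *
        (2 * \<mu> * (1 / ((g + sqrt (g\<^sup>2 - 1)) ^ (2 * k) * min x \<tau>)))"
proof -
  define c where "c = 2 * sin (b * pi) * \<tau> powr b / pi"
  define e where "e = 1 / ((g + sqrt (g\<^sup>2 - 1)) ^ (2 * k) * min x \<tau>)"
  let ?f = "\<lambda>t. 1 / (\<tau> * (1 - t) + x * (1 + t))"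
  define J where "J = pi / sin (b * pi) * x powr (b - 1) / (2 * \<tau> powr b)"
  have sin: "0 < sin (b * pi)" using b by (intro sin_gt_zero) auto
  have c0: "0 < c" unfolding c_def using sin \<tau> by simp
  have J: "((\<lambda>t. jacobi_weight b t * ?f t) has_integral J) {-1..1}"
    unfolding J_def by (rule has_integral_jacobi_resolvent[OF b \<tau> x])
  have xJ: "x powr b = x * (c * J)"
  proof -
    have "x * x powr (b - 1) = x powr b" using x by (simp add: powr_diff)
    then show ?thesis unfolding c_def J_def using sin \<tau> by (simp add: field_simps)
  qed
  have dist: "x + \<tau> - \<bar>x - \<tau>\<bar> = 2 * min x \<tau>" by (simp add: min_def)
  obtain p :: "real poly" where p: "degree p < 2 * k"
    and perr: "\<And>t. t \<in> {-1..1} \<Longrightarrow> \<bar>1 / ((x + \<tau>) + (x - \<tau>) * t) - poly p t\<bar>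
        \<le> 2 / ((g + sqrt (g\<^sup>2 - 1)) ^ (2 * k) * (x + \<tau> - \<bar>x - \<tau>\<bar>))"
    by (rule reciprocal_affine_approx_by_poly[of g "x - \<tau>" "x + \<tau>" "2 * k"]) (use g x \<tau> k in auto)
  have "\<bar>?f t - poly p t\<bar> \<le> e" if "t \<in> {-1..1}" for t
  proof -
    have "\<tau> * (1 - t) + x * (1 + t) = (x + \<tau>) + (x - \<tau>) * t" by (simp add: algebra_simps)
    then show ?thesis using perr[OF that] unfolding dist e_def by simp
  qed
  from gauss_rule_error_le[OF gauss k _ mass J p this]
  have err: "\<bar>J - (\<Sum>j=1..k. w j * ?f (\<theta> j))\<bar> \<le> 2 * \<mu> * e"
    by (simp add: jacobi_weight_def)
  have "x powr b - x * (c * (\<Sum>j=1..k. w j * ?f (\<theta> j))) = x * c * (J - (\<Sum>j=1..k. w j * ?f (\<theta> j)))"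
    unfolding xJ by (simp add: algebra_simps)
  then have "\<bar>x powr b - x * (c * (\<Sum>j=1..k. w j * ?f (\<theta> j)))\<bar>
      = x * c * \<bar>J - (\<Sum>j=1..k. w j * ?f (\<theta> j))\<bar>"
    using x c0 by (simp add: abs_mult)
  also have "\<dots> \<le> x * c * (2 * \<mu> * e)" using err x c0 by (intro mult_left_mono) auto
  finally show ?thesis unfolding c_def e_def .
qed

lemma diagonalized_by_eigenvalue:
  assumes Q: "orthogonal_matrix Q" and A: "diagonalized_by Q A d"
  shows "d i \<in> eigenvalues A"
proof -
  have "norm (column i Q) = 1" using Q unfolding orthogonal_matrix_orthonormal_columns by blast
  then have "column i Q \<noteq> 0" by auto
  then show ?thesis using A unfolding diagonalized_by_def eigenvalues_def by blast
qed

lemma sym_pos_def_eigenvalue_pos: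
  assumes "sym_pos_def A" "l \<in> eigenvalues A"
  shows "0 < l"
proof -
  obtain v where v: "v \<noteq> 0" "A *v v = l *\<^sub>R v" using assms(2) unfolding eigenvalues_def by blast
  then have "0 < l * (v \<bullet> v)" using assms(1) unfolding sym_pos_def_def by (metis inner_scaleR_right)
  moreover have "0 < v \<bullet> v" using v(1) by simp
  ultimately show ?thesis by (simp only: zero_less_mult_iff) linarith
qed

lemma spectral_norm_ge_eigenvalue:
  assumes "l \<in> eigenvalues A"
  shows "l \<le> spectral_norm A"
proof -
  obtain v where v: "v \<noteq> 0" "A *v v = l *\<^sub>R v" using assms unfolding eigenvalues_def by blast
  have "norm (A *v v) \<le> spectral_norm A * norm v"
    unfolding spectral_norm_def by (rule onorm) (rule matrix_vector_mul_bounded_linear)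
  then have "\<bar>l\<bar> * norm v \<le> spectral_norm A * norm v" unfolding v(2) by simp
  then show ?thesis using v(1) by (simp add: mult_le_cancel_right)
qed

theorem theorem2:
  fixes A :: "real^'n^'n"
    and lmin lmax \<beta> \<tau> \<kappa> \<gamma> \<rho> :: real
    and \<theta> w :: "nat \<Rightarrow> nat \<Rightarrow> real"
  assumes "sym_pos_def A"
    and "lmin \<in> eigenvalues A" and "\<forall>l\<in>eigenvalues A. lmin \<le> l"
    and "lmax \<in> eigenvalues A" and "\<forall>l\<in>eigenvalues A. l \<le> lmax"
    and "lmin < lmax"
    and "0 < \<beta>" and "\<beta> < 1"
    and "\<tau> = sqrt (lmin * lmax)"
    and "\<forall>k\<ge>1. gauss_rule (jacobi_weight \<beta>) k (\<theta> k) (w k)"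
    and "\<kappa> = lmax / lmin"
    and "\<gamma> = (sqrt \<kappa> + 1) / (sqrt \<kappa> - 1)"
    and "\<rho> = \<gamma> + sqrt (\<gamma>\<^sup>2 - 1)"
  shows "\<exists>C :: real. \<forall>\<^sub>F k in sequentially.
           spectral_norm (matrix_powr A \<beta> - gj_approx \<beta> \<tau> k (\<theta> k) (w k) A)
             \<le> C * spectral_norm A * \<tau> powr \<beta>
                 * ((\<rho> + 1) / ((\<rho> - 1) * (\<rho> - \<gamma>))) * (real k / \<rho> ^ (2 * k))"
proof -
  have lmin: "0 < lmin" by (rule sym_pos_def_eigenvalue_pos[OF assms(1,2)])
  have \<tau>: "lmin < \<tau>"
    unfolding assms(9) using lmin assms(6) by (intro real_less_rsqrt) (simp add: power2_eq_square)
  have "1 < sqrt \<kappa>" unfolding assms(11) using lmin assms(6) by simp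
  then have \<gamma>: "1 < \<gamma>" unfolding assms(12) by (simp add: field_simps)
  then have "1 < \<gamma>\<^sup>2" by (simp add: one_less_power)
  then have \<rho>\<gamma>: "\<gamma> < \<rho>" unfolding assms(13) by simp
  obtain Q d where Q: "orthogonal_matrix Q" and A: "diagonalized_by Q A d"
    by (rule symmetric_matrix_diagonalizable[of A]) (use assms(1) in \<open>auto simp: sym_pos_def_def\<close>)
  have d: "lmin \<le> d i" "d i \<le> lmax" for i
    using diagonalized_by_eigenvalue[OF Q A, of i] assms(3,5) by auto
  have gauss: "gauss_rule (jacobi_weight \<beta>) k (\<theta> k) (w k)" if "1 \<le> k" for k
    using assms(10) that by blast
  (* The one-point rule has the total mass of the weight as its only weight. *)
  define \<mu> where "\<mu> = w 1 1"
  have mass: "(jacobi_weight \<beta> has_integral \<mu>) {-1..1}"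
    using gauss_rule_has_integral_weight[OF gauss[of 1]] unfolding \<mu>_def by simp
  have \<mu>: "0 < \<mu>" unfolding \<mu>_def using gauss[of 1] unfolding gauss_rule_def by auto
  define c where "c = 2 * sin (\<beta> * pi) * \<tau> powr \<beta> / pi"
  have c: "0 < c" unfolding c_def using assms(7,8) lmin \<tau> by (auto intro!: divide_pos_pos mult_pos_pos sin_gt_zero)
  define K where "K = lmax * c * (2 * \<mu> / lmin)"
  have K: "0 < K" unfolding K_def using c \<mu> lmin assms(6) by simp
  define N where "N = spectral_norm A * \<tau> powr \<beta> * ((\<rho> + 1) / ((\<rho> - 1) * (\<rho> - \<gamma>)))"
  have "0 < spectral_norm A" using spectral_norm_ge_eigenvalue[OF assms(2)] lmin by linarith
  then have N: "0 < N" unfolding N_def using \<gamma> \<rho>\<gamma> \<tau> lmin by simp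
  have bound: "spectral_norm (matrix_powr A \<beta> - gj_approx \<beta> \<tau> k (\<theta> k) (w k) A)
      \<le> K / N * spectral_norm A * \<tau> powr \<beta>
         * ((\<rho> + 1) / ((\<rho> - 1) * (\<rho> - \<gamma>))) * (real k / \<rho> ^ (2 * k))" if k: "1 \<le> k" for k
  proof -
    have nodes: "- 1 < \<theta> k j \<and> \<theta> k j < 1" if "j \<in> {1..k}" for j
      using gauss[OF k] that unfolding gauss_rule_def by blast
    have dpos: "0 < d i" for i using d(1)[of i] lmin by linarith
    have \<tau>0: "0 < \<tau>" using \<tau> lmin by linarith
    have \<rho>k: "0 < \<rho> ^ (2 * k)" using \<gamma> \<rho>\<gamma> by simp
    have "spectral_norm (matrix_powr A \<beta> - gj_approx \<beta> \<tau> k (\<theta> k) (w k) A) \<le> K / \<rho> ^ (2 * k)"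
    proof (rule spectral_norm_le_if_diagonalized_by[OF Q
          diagonalized_by_diff[OF diagonalized_by_matrix_powr[OF Q A]
            diagonalized_by_gj_approx[OF Q A dpos \<tau>0 nodes]]])
      fix i
      have "\<bar>d i - \<tau>\<bar> * \<gamma> \<le> d i + \<tau>"
        by (rule geometric_mean_balances_poles[OF lmin assms(6) d assms(9)]) (simp add: assms(11,12))
      from scalar_gauss_jacobi_error_le[OF assms(7,8) \<tau>0 dpos k gauss[OF k] mass \<gamma> this]
      have "\<bar>d i powr \<beta> - d i * (2 * sin (\<beta> * pi) * \<tau> powr \<beta> / pi *
           (\<Sum>j=1..k. w k j * (1 / (\<tau> * (1 - \<theta> k j) + d i * (1 + \<theta> k j)))))\<bar>
        \<le> d i * c * (2 * \<mu> * (1 / (\<rho> ^ (2 * k) * min (d i) \<tau>)))"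
        unfolding c_def assms(13) .
      also have "\<dots> \<le> lmax * c * (2 * \<mu> * (1 / (\<rho> ^ (2 * k) * lmin)))"
        using d[of i] dpos[of i] c \<mu> \<rho>k lmin \<tau>
        by (intro mult_mono mult_left_mono frac_le mult_nonneg_nonneg) auto
      also have "\<dots> = K / \<rho> ^ (2 * k)" unfolding K_def by simp
      finally show "\<bar>d i powr \<beta> - d i * (2 * sin (\<beta> * pi) * \<tau> powr \<beta> / pi *
           (\<Sum>j=1..k. w k j * (1 / (\<tau> * (1 - \<theta> k j) + d i * (1 + \<theta> k j)))))\<bar> \<le> K / \<rho> ^ (2 * k)" .
    qed
    also have "\<dots> \<le> K * (real k / \<rho> ^ (2 * k))"
      using k K \<rho>k by (simp add: field_simps)
    also have "K * (real k / \<rho> ^ (2 * k)) = K / N * N * (real k / \<rho> ^ (2 * k))" using N by simp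
    also have "K / N * N = K / N * spectral_norm A * \<tau> powr \<beta>
        * ((\<rho> + 1) / ((\<rho> - 1) * (\<rho> - \<gamma>)))"
      by (subst (2) N_def) (simp only: mult.assoc)
    finally show ?thesis .
  qed
  show ?thesis
    by (intro exI[of _ "K / N"] eventually_sequentiallyI[of 1]) (rule bound)
qed

end
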